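(* Let $d\ge 1$ be an integer and let $\lambda_1,\dots,\lambda_d\in(0,1]$ and $\phi_0,\dots,\phi_{2d}:[0,1]\to[0,1]$ be fixed Kolmogorov data as described in the context. For $k\in\{1,2\}$ let $\mathcal K_k$ be the set of all $f\in C([0,1]^d)$ that can be written as $$f(x_1,\dots,x_d)=\sum_{q=0}^{2d} g\Big(\sum_{p=1}^d\lambda_p\phi_q(x_p)\Big),\qquad (x_1,\dots,x_d)\in[0,1]^d,$$ for some $g\in C^k([0,d])$. Then $\mathcal K_1$ and $\mathcal K_2$ are dense in $C([0,1]^d)$ with respect to the supremum norm. Moreover, for every $f\in\mathcal K_k$ there is a constant $C_f$ such that for every integer $n\ge1$ there is a continuous function $L$ on $[0,d]$ that is affine on each interval $[\frac{i-1}{n},\frac{i}{n}]$, $i=1,\dots,nd$ (so $L$ is determined by the $nd+1=O(nd)$ parameters $L(\frac in)$, $0\le i\le nd$), with $$\sup_{(x_1,\dots,x_d)\in[0,1]^d}\Big|f(x_1,\dots,x_d)-\sum_{q=0}^{2d}L\Big(\sum_{p=1}^d\lambda_p\phi_q(x_p)\Big)\Big|\le \frac{C_f}{n^k},$$ and one may take $C_f=\frac{2d+1}{2}\|g'\|_\infty$ if $k=1$ and $C_f=\frac{2d+1}{8}\|g''\|_\infty$ if $k=2$, where $g\in C^k([0,d])$ is any function satisfying $f(x_1,\dots,x_d)=\sum_{q=0}^{2d} g\big(\sum_{p=1}^d\lambda_p\phi_q(x_p)\big)$ for all $(x_1,\dots,x_d)\in[0,1]^d$.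
   Context: Kolmogorov data (Kolmogorov superposition theorem, Lorentz's version): fix numbers $0<\lambda_p\le 1$, $p=1,\dots,d$, and strictly increasing functions $\phi_q:[0,1]\to[0,1]$, $q=0,\dots,2d$, each Hölder continuous with exponent $\alpha\in(0,1)$, with the property that for every $f\in C([0,1]^d)$ there exists $g\in C([0,d])$ with $f(x_1,\dots,x_d)=\sum_{q=0}^{2d} g\big(\sum_{p=1}^d\lambda_p\phi_q(x_p)\big)$ on $[0,1]^d$. Such data exist by Lorentz's version of the Kolmogorov superposition theorem. $\|\cdot\|_\infty$ denotes the supremum norm on $[0,d]$. *)

theory Defs
  imports "HOL-Analysis.Analysis"
begin

(* The dimension d is CARD('d).  The index p ranges over the type 'd; the index q is a
   natural number in {0..2 * CARD('d)}. *)

abbreviation unit_cube :: "(real ^ 'd) set" where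
  "unit_cube \<equiv> cbox 0 1"

(* C([0,1]^d) with the metric of the supremum norm.  Its elements are the continuous functions
   on the cube, represented by functions that are undefined outside it. *)
abbreviation cube_fun_space :: "(real ^ 'd \<Rightarrow> real) metric" where
  "cube_fun_space \<equiv> cfunspace (top_of_set unit_cube) euclidean_metric"

definition sup_norm :: "'a set \<Rightarrow> ('a \<Rightarrow> real) \<Rightarrow> real" where
  "sup_norm S h = (SUP x\<in>S. \<bar>h x\<bar>)"

(* The derivative relative to S: one-sided at the end points of a closed interval. *)
definition deriv_on :: "real set \<Rightarrow> (real \<Rightarrow> real) \<Rightarrow> real \<Rightarrow> real" where
  "deriv_on S g = (\<lambda>t. vector_derivative g (at t within S))"

fun C_k_on :: "nat \<Rightarrow> real set \<Rightarrow> (real \<Rightarrow> real) \<Rightarrow> bool" where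
  "C_k_on 0 S g \<longleftrightarrow> continuous_on S g"
| "C_k_on (Suc k) S g \<longleftrightarrow> g differentiable_on S \<and> C_k_on k S (deriv_on S g)"

definition holder_on :: "real \<Rightarrow> real set \<Rightarrow> (real \<Rightarrow> real) \<Rightarrow> bool" where
  "holder_on \<alpha> S h \<longleftrightarrow> (\<exists>C. \<forall>x\<in>S. \<forall>y\<in>S. \<bar>h x - h y\<bar> \<le> C * \<bar>x - y\<bar> powr \<alpha>)"

definition superposition ::
  "('d::finite \<Rightarrow> real) \<Rightarrow> (nat \<Rightarrow> real \<Rightarrow> real) \<Rightarrow> (real \<Rightarrow> real) \<Rightarrow> real ^ 'd \<Rightarrow> real" where
  "superposition lam \<phi> g x = (\<Sum>q = 0..2 * CARD('d). g (\<Sum>p\<in>UNIV. lam p * \<phi> q (x $ p)))"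

definition kolmogorov_data ::
  "real \<Rightarrow> ('d::finite \<Rightarrow> real) \<Rightarrow> (nat \<Rightarrow> real \<Rightarrow> real) \<Rightarrow> bool" where
  "kolmogorov_data \<alpha> lam \<phi> \<longleftrightarrow>
     0 < \<alpha> \<and> \<alpha> < 1 \<and>
     (\<forall>p. 0 < lam p \<and> lam p \<le> 1) \<and>
     (\<forall>q \<le> 2 * CARD('d).
        \<phi> q ` {0..1} \<subseteq> {0..1} \<and> strict_mono_on {0..1} (\<phi> q) \<and> holder_on \<alpha> {0..1} (\<phi> q)) \<and>
     (\<forall>f \<in> mspace (cube_fun_space :: (real ^ 'd \<Rightarrow> real) metric).
        \<exists>g. continuous_on {0..real CARD('d)} g \<and>
            (\<forall>x\<in>unit_cube. f x = superposition lam \<phi> g x))"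

definition kolmogorov_class ::
  "('d::finite \<Rightarrow> real) \<Rightarrow> (nat \<Rightarrow> real \<Rightarrow> real) \<Rightarrow> nat \<Rightarrow> (real ^ 'd \<Rightarrow> real) set" where
  "kolmogorov_class lam \<phi> k =
     {f \<in> mspace cube_fun_space.
        \<exists>g. C_k_on k {0..real CARD('d)} g \<and> (\<forall>x\<in>unit_cube. f x = superposition lam \<phi> g x)}"

definition grid_affine :: "nat \<Rightarrow> nat \<Rightarrow> (real \<Rightarrow> real) \<Rightarrow> bool" where
  "grid_affine d n L \<longleftrightarrow>
     continuous_on {0..real d} L \<and>
     (\<forall>i\<in>{1..n * d}. \<exists>a b. \<forall>t\<in>{(real i - 1) / real n..real i / real n}. L t = a * t + b)"

end

theory Submission
  imports Defs
begin

text \<open>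
  Replacing the outer function \<open>g\<close> by any \<open>h\<close> changes the superposition by at most
  \<open>2d + 1\<close> times the uniform distance of \<open>g\<close> and \<open>h\<close> on \<open>[0, d]\<close>. With \<open>h\<close> a
  polynomial (Weierstrass) this gives density; with \<open>h\<close> the piecewise linear interpolant of \<open>g\<close> on
  the grid of width \<open>1/n\<close> it gives the error bounds.
\<close>

section \<open>Linear interpolation on one interval\<close>

definition chord :: "(real \<Rightarrow> real) \<Rightarrow> real \<Rightarrow> real \<Rightarrow> real \<Rightarrow> real" where
  "chord g a b t = g a + (t - a) / (b - a) * (g b - g a)"

lemma chord_left [simp]: "chord g a b a = g a"
  by (simp add: chord_def)

lemma chord_right [simp]: "a < b \<Longrightarrow> chord g a b b = g b"
  by (simp add: chord_def)

text \<open>Clearing the denominator writes the error as a weighted difference of the increments of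
  \<open>g\<close> over [a, t] and [t, b], so that the mean value theorem can be applied to each
  piece.\<close>

lemma chord_error:
  assumes "a < b"
  shows "(b - a) * (g t - chord g a b t) = (b - t) * (g t - g a) - (t - a) * (g b - g t)"
proof -
  have "(b - a) * chord g a b t = (b - a) * g a + (t - a) * (g b - g a)"
    using assms by (simp add: chord_def distrib_left)
  then show ?thesis
    by (simp add: algebra_simps)
qed

text \<open>Derivatives within \<open>S\<close> restrict to \<open>{a..b}\<close>, so one-sided
  derivatives at the ends of \<open>S\<close> suffice. The case \<open>a = b\<close> is allowed
  because the interpolation point may be an end of its cell.\<close>

lemma real_mvt_within:
  fixes f :: "real \<Rightarrow> real"
  assumes "a \<le> b" "{a..b} \<subseteq> S"
    and der: "\<And>x. x \<in> S \<Longrightarrow> (f has_real_derivative f' x) (at x within S)"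
  obtains x where "x \<in> {a..b}" "f b - f a = f' x * (b - a)"
proof -
  have "(f has_derivative (*) (f' x)) (at x within {a..b})" if "a \<le> x" "x \<le> b" for x
  proof -
    have "x \<in> S"
      using that assms(2) by auto
    then have "(f has_real_derivative f' x) (at x within {a..b})"
      by (intro has_field_derivative_subset[OF der assms(2)])
    then show ?thesis
      by (simp add: has_field_derivative_def)
  qed
  from mvt_very_simple[OF assms(1) this] show thesis
    using that by blast
qed

text \<open>Arithmetic-geometric mean inequality for two numbers with sum
  \<open>b - a\<close>.\<close>

lemma product_le_quarter_square: "(t - a) * (b - t) \<le> (b - a)\<^sup>2 / (4 :: real)"
proof -
  have "0 \<le> ((t - a) - (b - t))\<^sup>2"
    by simp
  then show ?thesis
    by (simp add: power2_eq_square algebra_simps)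
qed

text \<open>The mean slopes on both sides of \<open>t\<close> are values of \<open>g'\<close>, so
  they differ by at most \<open>2 * M\<close>. Their difference is weighted by
  \<open>(t - a) * (b - t)\<close>, at most a quarter of the squared length, which yields the
  constant 2/4 = 1/2.\<close>

lemma chord_error_C1:
  assumes "a < b" "t \<in> {a..b}" "{a..b} \<subseteq> S"
    and der: "\<And>x. x \<in> S \<Longrightarrow> (g has_real_derivative g' x) (at x within S)"
    and bound: "\<And>x. x \<in> S \<Longrightarrow> \<bar>g' x\<bar> \<le> M"
  shows "\<bar>g t - chord g a b t\<bar> \<le> M * (b - a) / 2"
proof -
  have at: "a \<le> t" "{a..t} \<subseteq> S" and tb: "t \<le> b" "{t..b} \<subseteq> S"
    using assms(2,3) by auto
  obtain u where u: "u \<in> {a..t}" "g t - g a = g' u * (t - a)"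
    using real_mvt_within[OF at der] by blast
  obtain v where v: "v \<in> {t..b}" "g b - g t = g' v * (b - t)"
    using real_mvt_within[OF tb der] by blast
  have "\<bar>g' u - g' v\<bar> \<le> 2 * M"
  proof -
    have "u \<in> S" "v \<in> S"
      using u(1) v(1) at(2) tb(2) by blast+
    then show ?thesis
      using bound[of u] bound[of v] by linarith
  qed
  have "(b - a) * \<bar>g t - chord g a b t\<bar> = \<bar>(b - a) * (g t - chord g a b t)\<bar>"
    using assms(1) by (simp add: abs_mult)
  also have "(b - a) * (g t - chord g a b t) = (g' u - g' v) * ((t - a) * (b - t))"
    unfolding chord_error[OF assms(1)] u(2) v(2) by (simp add: algebra_simps)
  also have "\<bar>\<dots>\<bar> = \<bar>g' u - g' v\<bar> * ((t - a) * (b - t))"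
    using assms(2) by (simp add: abs_mult)
  also have "\<dots> \<le> (2 * M) * ((b - a)\<^sup>2 / 4)"
    using \<open>\<bar>g' u - g' v\<bar> \<le> 2 * M\<close> assms(2) product_le_quarter_square
    by (intro mult_mono) auto
  also have "\<dots> = (b - a) * (M * (b - a) / 2)"
    by (simp add: power2_eq_square)
  finally show ?thesis
    using assms(1) by (simp add: mult_le_cancel_left_pos)
qed

text \<open>A function with increasing derivative is convex: its mean slope before \<open>t\<close>
  does not exceed its mean slope after \<open>t\<close>.\<close>

lemma le_chord_if_deriv_mono:
  assumes "a < b" "t \<in> {a..b}" "{a..b} \<subseteq> S"
    and der: "\<And>x. x \<in> S \<Longrightarrow> (h has_real_derivative h' x) (at x within S)"
    and mono: "\<And>x y. \<lbrakk>x \<in> {a..b}; y \<in> {a..b}; x \<le> y\<rbrakk> \<Longrightarrow> h' x \<le> h' y"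
  shows "h t \<le> chord h a b t"
proof -
  have at: "a \<le> t" "{a..t} \<subseteq> S" and tb: "t \<le> b" "{t..b} \<subseteq> S"
    using assms(2,3) by auto
  obtain u where u: "u \<in> {a..t}" "h t - h a = h' u * (t - a)"
    using real_mvt_within[OF at der] by blast
  obtain v where v: "v \<in> {t..b}" "h b - h t = h' v * (b - t)"
    using real_mvt_within[OF tb der] by blast
  have "h' u \<le> h' v"
    using mono[of u v] u(1) v(1) by auto
  moreover have "(b - a) * (h t - chord h a b t) = (h' u - h' v) * ((t - a) * (b - t))"
    unfolding chord_error[OF assms(1)] u(2) v(2) by (simp add: algebra_simps)
  ultimately have "(b - a) * (h t - chord h a b t) \<le> 0"
    using assms(2) by (simp add: mult_nonpos_nonneg)
  then show ?thesis
    using assms(1) by (simp add: mult_le_0_iff)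
qed

text \<open>Adding \<open>M / 2 * x\<^sup>2\<close> makes \<open>g\<close> convex, hence bounded
  above by its chord. The error is then at most the chord error of the added quadratic, whose
  maximum, at the midpoint, gives the constant 1/2 * 1/4 = 1/8.\<close>

lemma chord_error_C2_upper:
  assumes "a < b" "t \<in> {a..b}" "{a..b} \<subseteq> S"
    and der: "\<And>x. x \<in> S \<Longrightarrow> (g has_real_derivative g' x) (at x within S)"
    and der2: "\<And>x. x \<in> S \<Longrightarrow> (g' has_real_derivative g'' x) (at x within S)"
    and bound: "\<And>x. x \<in> S \<Longrightarrow> - M \<le> g'' x" and "0 \<le> M"
  shows "g t - chord g a b t \<le> M * (b - a)\<^sup>2 / 8"
proof -
  \<comment> \<open>\<open>h\<close> is convex because \<open>h'' = g'' + M\<close> is nonnegative.\<close>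
  define h where "h x = g x + M / 2 * x\<^sup>2" for x
  have der_h: "(h has_real_derivative g' x + M * x) (at x within S)" if "x \<in> S" for x
    unfolding h_def using der[OF that] by (auto intro!: derivative_eq_intros)
  have "g' x + M * x \<le> g' y + M * y" if xy: "x \<in> {a..b}" "y \<in> {a..b}" "x \<le> y" for x y
  proof -
    have sub: "{x..y} \<subseteq> S"
      using xy assms(3) by auto
    then obtain w where w: "w \<in> {x..y}" "g' y - g' x = g'' w * (y - x)"
      using real_mvt_within[OF xy(3) sub der2] by blast
    have "- M * (y - x) \<le> g'' w * (y - x)"
      using bound[of w] w(1) sub xy(3) by (intro mult_right_mono) auto
    then show ?thesis
      using w(2) by (simp add: algebra_simps)
  qed
  then have "h t \<le> chord h a b t"
    using le_chord_if_deriv_mono[of a b t S h "\<lambda>x. g' x + M * x"] assms(1-3) der_h by blast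
  \<comment> \<open>The chord is linear in the function, and the bracket is the chord of the square
    function.\<close>
  moreover have "chord h a b t = chord g a b t + M / 2 * (a\<^sup>2 + (t - a) * (a + b))"
  proof -
    define s where "s = (t - a) / (b - a)"
    have chord_s: "chord k a b t = k a + s * (k b - k a)" for k
      by (simp add: chord_def s_def)
    have "s * (b\<^sup>2 - a\<^sup>2) = (t - a) * (a + b)"
      using assms(1) by (simp add: s_def power2_eq_square square_diff_square_factored)
    then have "M / 2 * (s * (b\<^sup>2 - a\<^sup>2)) = M / 2 * ((t - a) * (a + b))"
      by simp
    then show ?thesis
      unfolding chord_s h_def by (simp add: algebra_simps)
  qed
  \<comment> \<open>The chord of the square function exceeds \<open>t\<^sup>2\<close> by exactly
    \<open>(t - a) * (b - t)\<close>.\<close>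
  ultimately have "g t - chord g a b t \<le> M / 2 * ((t - a) * (b - t))"
    by (simp add: h_def power2_eq_square algebra_simps)
  also have "\<dots> \<le> M / 2 * ((b - a)\<^sup>2 / 4)"
    using \<open>0 \<le> M\<close> product_le_quarter_square by (intro mult_left_mono) auto
  finally show ?thesis
    by simp
qed

text \<open>The one-sided estimate is applied to \<open>g\<close> and to \<open>- g\<close>; the
  chord changes sign with the function.\<close>

lemma chord_error_C2:
  assumes "a < b" "t \<in> {a..b}" "{a..b} \<subseteq> S"
    and der: "\<And>x. x \<in> S \<Longrightarrow> (g has_real_derivative g' x) (at x within S)"
    and der2: "\<And>x. x \<in> S \<Longrightarrow> (g' has_real_derivative g'' x) (at x within S)"
    and bound: "\<And>x. x \<in> S \<Longrightarrow> \<bar>g'' x\<bar> \<le> M"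
  shows "\<bar>g t - chord g a b t\<bar> \<le> M * (b - a)\<^sup>2 / 8"
proof -
  have "0 \<le> M"
    using bound[of a] assms(1,3) by fastforce
  have "- M \<le> g'' x" "- M \<le> - g'' x" if "x \<in> S" for x
    using bound[OF that] by auto
  then have "g t - chord g a b t \<le> M * (b - a)\<^sup>2 / 8"
    and "- g t - chord (\<lambda>x. - g x) a b t \<le> M * (b - a)\<^sup>2 / 8"
    using chord_error_C2_upper[OF assms(1-3) der der2 _ \<open>0 \<le> M\<close>]
      chord_error_C2_upper[OF assms(1-3) DERIV_minus[OF der] DERIV_minus[OF der2] _ \<open>0 \<le> M\<close>]
    by auto
  moreover have "chord (\<lambda>x. - g x) a b t = - chord g a b t"
    using mult_minus_right[of "(t - a) / (b - a)" "g b - g a"] by (simp add: chord_def)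
  ultimately show ?thesis
    by linarith
qed

section \<open>Piecewise linear interpolation on a grid\<close>

text \<open>The floor assigns a node to the cell on its right. At the right end d of the domain this
  cell lies outside [0, d], but the chord at its left end is still \<open>g\<close> at d.\<close>

definition grid_interpolant :: "(real \<Rightarrow> real) \<Rightarrow> nat \<Rightarrow> real \<Rightarrow> real" where
  "grid_interpolant g n t =
     (let i = nat \<lfloor>t * real n\<rfloor> in chord g (real i / real n) ((real i + 1) / real n) t)"

text \<open>At the right end of a cell the definition already uses the next chord, but both chords
  take the value of \<open>g\<close> there. Elsewhere in the cell the floor is \<open>i - 1\<close>,
  since cells are counted from 1.\<close>

lemma grid_interpolant_cell:
  assumes "n \<ge> 1" "i \<ge> 1" "t \<in> {(real i - 1) / real n..real i / real n}"
  shows "grid_interpolant g n t = chord g ((real i - 1) / real n) (real i / real n) t"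
proof (cases "t = real i / real n")
  case True
  have "(real i - 1) / real n < real i / real n" "real i / real n < (real i + 1) / real n"
    using assms(1) by (simp_all add: divide_strict_right_mono)
  then show ?thesis
    using assms(1) True by (simp add: grid_interpolant_def)
next
  case False
  then have "real i - 1 \<le> t * real n" "t * real n < real i"
    using assms by (auto simp: field_simps)
  then have "\<lfloor>t * real n\<rfloor> = int i - 1"
    by (simp add: floor_eq_iff)
  then have "nat \<lfloor>t * real n\<rfloor> = i - 1"
    by (simp add: nat_diff_distrib')
  then show ?thesis
    using assms(2) by (simp add: grid_interpolant_def of_nat_diff)
qed

lemma grid_cells_cover:
  assumes "n \<ge> 1" "d \<ge> 1"
  shows "{0..real d} = (\<Union>i\<in>{1..n * d}. {(real i - 1) / real n..real i / real n})"
proof (intro subset_antisym subsetI)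
  fix t assume t: "t \<in> {0..real d}"
  \<comment> \<open>The ceiling picks the cell that contains \<open>t\<close> in its interior or as
    its right end; the maximum moves \<open>t = 0\<close>, where the ceiling is 0, into the first
    cell.\<close>
  define i where "i = max 1 (nat \<lceil>t * real n\<rceil>)"
  have "0 \<le> t * real n" "t * real n \<le> real (n * d)"
    using t assms(1) by (simp_all add: mult.commute mult_left_mono)
  moreover from this have "\<lceil>t * real n\<rceil> \<le> int (n * d)"
    by (simp add: ceiling_le_iff)
  ultimately have "i \<in> {1..n * d}"
    using assms by (auto simp: i_def nat_le_iff Suc_le_eq)
  moreover have "real i - 1 \<le> t * real n" "t * real n \<le> real i"
    using \<open>0 \<le> t * real n\<close> unfolding i_def by (auto simp: max_def of_nat_nat) linarith+
  then have "t \<in> {(real i - 1) / real n..real i / real n}"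
    using assms(1) by (simp add: field_simps)
  ultimately show "t \<in> (\<Union>i\<in>{1..n * d}. {(real i - 1) / real n..real i / real n})"
    by blast
next
  fix t assume "t \<in> (\<Union>i\<in>{1..n * d}. {(real i - 1) / real n..real i / real n})"
  then obtain i where i: "i \<ge> 1" "i \<le> n * d"
    and t: "(real i - 1) / real n \<le> t" "t \<le> real i / real n"
    by auto
  have "0 \<le> (real i - 1) / real n"
    using i(1) by simp
  moreover have "real i \<le> real d * real n"
    using i(2) by (metis mult.commute of_nat_le_iff of_nat_mult)
  then have "real i / real n \<le> real d"
    using assms(1) by (simp add: divide_le_eq)
  ultimately show "t \<in> {0..real d}"
    using t by simp
qed

lemma grid_affine_grid_interpolant:
  assumes "n \<ge> 1" "d \<ge> 1"
  shows "grid_affine d n (grid_interpolant g n)"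
proof -
  have affine: "\<exists>a b. \<forall>t\<in>{(real i - 1) / real n..real i / real n}. grid_interpolant g n t = a * t + b"
    if i: "i \<in> {1..n * d}" for i
  proof -
    define u v where "u = (real i - 1) / real n" and "v = real i / real n"
    define c where "c = (g v - g u) / (v - u)"
    have "grid_interpolant g n t = c * t + (g u - c * u)" if "t \<in> {u..v}" for t
    proof -
      have "grid_interpolant g n t = chord g u v t"
        using grid_interpolant_cell[of n i t g] that i assms(1) by (simp add: u_def v_def)
      also have "\<dots> = g u + c * (t - u)"
        by (simp add: chord_def c_def)
      finally show ?thesis
        by (simp add: algebra_simps)
    qed
    then show ?thesis
      unfolding u_def v_def by blast
  qed
  \<comment> \<open>The closed cells form a finite cover of [0, d], and an affine function is
    continuous on each, so the pieces glue.\<close>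
  moreover have "continuous_on {0..real d} (grid_interpolant g n)"
    unfolding grid_cells_cover[OF assms]
  proof (rule continuous_on_closed_Union)
    fix i assume "i \<in> {1..n * d}"
    from affine[OF this] obtain a b where
      "\<forall>t\<in>{(real i - 1) / real n..real i / real n}. grid_interpolant g n t = a * t + b"
      by blast
    then show "continuous_on {(real i - 1) / real n..real i / real n} (grid_interpolant g n)"
      using continuous_on_cong[of _ _ "\<lambda>t. a * t + b" "grid_interpolant g n"]
      by (fastforce intro!: continuous_intros)
  qed auto
  ultimately show ?thesis
    by (simp add: grid_affine_def)
qed

text \<open>Reduces a uniform bound to one for a single chord over an arbitrary subinterval of
  length 1/n, the form in which both smoothness classes supply it.\<close>

lemma grid_interpolant_error:
  assumes "n \<ge> 1" "d \<ge> 1" "t \<in> {0..real d}"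
    and cell: "\<And>a b t. \<lbrakk>a < b; b - a = 1 / real n; {a..b} \<subseteq> {0..real d}; t \<in> {a..b}\<rbrakk>
      \<Longrightarrow> \<bar>g t - chord g a b t\<bar> \<le> e"
  shows "\<bar>g t - grid_interpolant g n t\<bar> \<le> e"
proof -
  obtain i where i: "i \<in> {1..n * d}" "t \<in> {(real i - 1) / real n..real i / real n}"
    using assms(3) unfolding grid_cells_cover[OF assms(1,2)] by blast
  then have "{(real i - 1) / real n..real i / real n} \<subseteq> {0..real d}"
    unfolding grid_cells_cover[OF assms(1,2)] by blast
  moreover have "real i / real n - (real i - 1) / real n = 1 / real n"
    by (simp add: diff_divide_distrib)
  moreover from this have "(real i - 1) / real n < real i / real n"
    using assms(1) by (simp add: divide_strict_right_mono)
  ultimately show ?thesis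
    using cell i grid_interpolant_cell[of n i t g] assms(1) by simp
qed

text \<open>This is the parameter count: on each cell two affine functions that agree at both ends
  have the same slope and intercept, so the nd + 1 node values determine the function.\<close>

lemma grid_affine_unique:
  assumes "n \<ge> 1" "d \<ge> 1" "grid_affine d n L" "grid_affine d n M" "t \<in> {0..real d}"
    and nodes: "\<forall>i\<in>{0..n * d}. L (real i / real n) = M (real i / real n)"
  shows "L t = M t"
proof -
  obtain i where i: "i \<in> {1..n * d}" "t \<in> {(real i - 1) / real n..real i / real n}"
    using assms(5) unfolding grid_cells_cover[OF assms(1,2)] by blast
  define u v where "u = (real i - 1) / real n" and "v = real i / real n"
  have "u < v"
    using assms(1) by (simp add: u_def v_def divide_strict_right_mono)
  have t: "t \<in> {u..v}"
    using i(2) by (simp add: u_def v_def)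
  obtain a b where L: "\<forall>t\<in>{u..v}. L t = a * t + b"
    using assms(3) i(1) unfolding grid_affine_def u_def v_def by blast
  obtain a' b' where M: "\<forall>t\<in>{u..v}. M t = a' * t + b'"
    using assms(4) i(1) unfolding grid_affine_def u_def v_def by blast
  have "L v = M v" "L u = M u"
    using nodes[rule_format, of i] nodes[rule_format, of "i - 1"] i(1)
    by (auto simp: u_def v_def of_nat_diff)
  then have *: "a * v + b = a' * v + b'" "a * u + b = a' * u + b'"
    using L M \<open>u < v\<close> by simp_all
  then have "(a - a') * (v - u) = 0"
    by (simp add: algebra_simps)
  then have "a = a'"
    using \<open>u < v\<close> by simp
  then show ?thesis
    using * L M t by simp
qed

section \<open>The classes of continuously differentiable functions\<close>

text \<open>Derivatives within \<open>S\<close> at points of \<open>S\<close> see only values on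
  \<open>S\<close>. This lets \<open>deriv_on\<close> be replaced by a formula that is valid on
  \<open>S\<close> alone.\<close>

lemma C_k_on_cong:
  assumes "\<And>x. x \<in> S \<Longrightarrow> f x = g x"
  shows "C_k_on k S f \<longleftrightarrow> C_k_on k S g"
  using assms
proof (induction k arbitrary: f g)
  case 0
  then show ?case
    by (simp cong: continuous_on_cong)
next
  case (Suc k)
  have "f differentiable_on S \<longleftrightarrow> g differentiable_on S"
    unfolding differentiable_on_def differentiable_def
    using Suc.prems by (metis has_derivative_transform)
  moreover have "deriv_on S f x = deriv_on S g x" if "x \<in> S" for x
    unfolding deriv_on_def using Suc.prems that
    by (intro vector_derivative_cong_eq) auto
  then have "C_k_on k S (deriv_on S f) \<longleftrightarrow> C_k_on k S (deriv_on S g)"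
    by (rule Suc.IH)
  ultimately show ?case
    by simp
qed

lemma has_real_derivative_deriv_on:
  assumes "g differentiable_on S" "x \<in> S"
  shows "(g has_real_derivative deriv_on S g x) (at x within S)"
  using assms vector_derivative_works[of g "at x within S"]
  by (auto simp: differentiable_on_def deriv_on_def has_real_derivative_iff_has_vector_derivative)

text \<open>Induction works because the derivative of a polynomial is a polynomial. With
  \<open>a < b\<close> the derivative within the interval is unique, so \<open>deriv_on\<close>
  agrees there with \<open>p'\<close>.\<close>

lemma C_k_on_real_polynomial_function:
  assumes "real_polynomial_function p" "a < b"
  shows "C_k_on k {a..b} p"
  using assms(1)
proof (induction k arbitrary: p)
  case 0
  then show ?case
    by (auto intro!: continuous_at_imp_continuous_on continuous_real_polymonial_function)
next
  case (Suc k)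
  obtain p' where p': "real_polynomial_function p'" "\<And>x. (p has_real_derivative p' x) (at x)"
    using has_real_derivative_polynomial_function[OF Suc.prems] by blast
  have "deriv_on {a..b} p x = p' x" if "x \<in> {a..b}" for x
    unfolding deriv_on_def
    using p'(2) assms(2) that
    by (intro vector_derivative_within_closed_interval)
      (auto simp: has_real_derivative_iff_has_vector_derivative[symmetric]
            intro: has_field_derivative_at_within)
  then have "C_k_on k {a..b} (deriv_on {a..b} p)"
    using C_k_on_cong[of "{a..b}" "deriv_on {a..b} p" p' k] Suc.IH[OF p'(1)] by blast
  moreover have "p differentiable_on {a..b}"
    unfolding differentiable_on_def
    using p'(2) by (meson has_field_derivative_at_within has_field_derivative_imp_has_derivative differentiableI)
  ultimately show ?case
    by simp
qed

text \<open>Continuity on a compact set bounds the values, so the supremum is a genuine upper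
  bound.\<close>

lemma abs_le_sup_norm:
  assumes "continuous_on S h" "compact S" "x \<in> S"
  shows "\<bar>h x\<bar> \<le> sup_norm S h"
  unfolding sup_norm_def
proof (rule cSUP_upper[OF assms(3)])
  have "compact ((\<lambda>x. \<bar>h x\<bar>) ` S)"
    using assms by (intro compact_continuous_image continuous_intros)
  then show "bdd_above ((\<lambda>x. \<bar>h x\<bar>) ` S)"
    by (intro bounded_imp_bdd_above compact_imp_bounded)
qed

section \<open>Superpositions\<close>

text \<open>Each of the d summands lies in [0, 1]. Hence the outer function is evaluated only on
  [0, d].\<close>

lemma kolmogorov_data_inner_bounds:
  fixes lam :: "'d::finite \<Rightarrow> real"
  assumes "kolmogorov_data \<alpha> lam \<phi>" "x \<in> unit_cube" "q \<le> 2 * CARD('d)"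
  shows "(\<Sum>p\<in>UNIV. lam p * \<phi> q (x $ p)) \<in> {0..real CARD('d)}"
proof -
  have "0 \<le> lam p * \<phi> q (x $ p) \<and> lam p * \<phi> q (x $ p) \<le> 1" for p
  proof -
    have "x $ p \<in> {0..1}"
      using assms(2) by (simp add: mem_box_cart)
    then have "\<phi> q (x $ p) \<in> {0..1}"
      using assms(1,3) unfolding kolmogorov_data_def by blast
    moreover have "0 < lam p" "lam p \<le> 1"
      using assms(1) unfolding kolmogorov_data_def by blast+
    ultimately show ?thesis
      by (simp add: mult_le_one)
  qed
  then have "0 \<le> (\<Sum>p\<in>UNIV. lam p * \<phi> q (x $ p))"
    and "(\<Sum>p\<in>UNIV. lam p * \<phi> q (x $ p)) \<le> (\<Sum>p\<in>(UNIV :: 'd set). 1)"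
    by (blast intro: sum_nonneg sum_mono)+
  then show ?thesis
    by simp
qed

lemma superposition_diff_le:
  fixes lam :: "'d::finite \<Rightarrow> real"
  assumes "kolmogorov_data \<alpha> lam \<phi>" "x \<in> unit_cube"
    and "\<And>t. t \<in> {0..real CARD('d)} \<Longrightarrow> \<bar>g t - h t\<bar> \<le> e"
  shows "\<bar>superposition lam \<phi> g x - superposition lam \<phi> h x\<bar> \<le> (2 * real CARD('d) + 1) * e"
proof -
  let ?y = "\<lambda>q. \<Sum>p\<in>UNIV. lam p * \<phi> q (x $ p)"
  have "\<bar>superposition lam \<phi> g x - superposition lam \<phi> h x\<bar> =
      \<bar>\<Sum>q = 0..2 * CARD('d). g (?y q) - h (?y q)\<bar>"
    by (simp add: superposition_def sum_subtractf)
  also have "\<dots> \<le> (\<Sum>q = 0..2 * CARD('d). \<bar>g (?y q) - h (?y q)\<bar>)"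
    by (rule sum_abs)
  also have "\<dots> \<le> (\<Sum>q = 0..2 * CARD('d). e)"
    using assms kolmogorov_data_inner_bounds[OF assms(1,2)] by (intro sum_mono) auto
  also have "\<dots> = (2 * real CARD('d) + 1) * e"
    by (simp add: algebra_simps)
  finally show ?thesis .
qed

text \<open>Supplies the continuity of the inner functions, which the Kolmogorov data contain only
  through the Hoelder condition.\<close>

lemma holder_on_imp_continuous_on:
  assumes "holder_on \<alpha> S h" "0 < \<alpha>"
  shows "continuous_on S h"
proof -
  obtain C where C: "\<And>x y. \<lbrakk>x \<in> S; y \<in> S\<rbrakk> \<Longrightarrow> \<bar>h x - h y\<bar> \<le> C * \<bar>x - y\<bar> powr \<alpha>"
    using assms(1) unfolding holder_on_def by blast
  have "(h \<longlongrightarrow> h x) (at x within S)" if "x \<in> S" for x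
  proof -
    have "((\<lambda>y. C * \<bar>y - x\<bar> powr \<alpha>) \<longlongrightarrow> C * \<bar>x - x\<bar> powr \<alpha>) (at x within S)"
      using assms(2) by (intro tendsto_intros) auto
    then have "((\<lambda>y. C * \<bar>y - x\<bar> powr \<alpha>) \<longlongrightarrow> 0) (at x within S)"
      using assms(2) by simp
    then have "((\<lambda>y. h y - h x) \<longlongrightarrow> 0) (at x within S)"
      by (rule Lim_null_comparison[rotated]) (use C that in \<open>auto simp: eventually_at_filter\<close>)
    then show ?thesis
      by (simp add: LIM_zero_iff)
  qed
  then show ?thesis
    by (simp add: continuous_on_def)
qed

lemma continuous_on_superposition:
  fixes lam :: "'d::finite \<Rightarrow> real"
  assumes K: "kolmogorov_data \<alpha> lam \<phi>" and g: "continuous_on {0..real CARD('d)} g"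
  shows "continuous_on unit_cube (superposition lam \<phi> g)"
proof -
  have "continuous_on unit_cube (\<lambda>x. g (\<Sum>p\<in>UNIV. lam p * \<phi> q (x $ p)))"
    if q: "q \<le> 2 * CARD('d)" for q
  proof (rule continuous_on_compose2[OF g])
    have "continuous_on {0..1} (\<phi> q)"
      using K q unfolding kolmogorov_data_def by (blast intro: holder_on_imp_continuous_on)
    then have "continuous_on unit_cube (\<lambda>x. \<phi> q (x $ p))" for p :: 'd
      by (rule continuous_on_compose2) (auto intro!: continuous_intros simp: mem_box_cart)
    then show "continuous_on unit_cube (\<lambda>x. \<Sum>p\<in>UNIV. lam p * \<phi> q (x $ p))"
      by (intro continuous_intros)
  qed (use kolmogorov_data_inner_bounds[OF K _ q] in blast)
  then show ?thesis
    unfolding superposition_def by (intro continuous_on_sum) auto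
qed

lemma unit_cube_nonempty: "(unit_cube :: (real ^ 'd) set) \<noteq> {}"
  by (auto simp: mem_box_cart intro!: exI[of _ 0] simp flip: ex_in_conv)

text \<open>Elements of the function space are undefined outside the cube, hence the restriction;
  boundedness comes from compactness of the cube.\<close>

lemma restrict_in_cube_fun_space:
  assumes "continuous_on unit_cube f"
  shows "restrict f unit_cube \<in> mspace (cube_fun_space :: (real ^ 'd \<Rightarrow> real) metric)"
proof -
  have cont: "continuous_on unit_cube (restrict f unit_cube)"
    using assms by (simp cong: continuous_on_cong)
  moreover have "bounded (restrict f unit_cube ` unit_cube)"
    using cont by (intro compact_imp_bounded compact_continuous_image) auto
  ultimately show ?thesis
    by (simp add: mbounded_iff_bounded)
qed

section \<open>Density of the classes in the supremum norm\<close>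

text \<open>A continuous outer function of \<open>f\<close> is replaced by a polynomial
  approximation. Polynomials are k times continuously differentiable for every \<open>k\<close>, so
  one argument covers all classes.\<close>

lemma kolmogorov_class_dense:
  fixes lam :: "'d::finite \<Rightarrow> real"
  assumes K: "kolmogorov_data \<alpha> lam \<phi>"
  shows "mtopology_of cube_fun_space closure_of kolmogorov_class lam \<phi> k = mspace cube_fun_space"
proof -
  interpret F: Metric_space "mspace cube_fun_space" "mdist (cube_fun_space :: (real ^ 'd \<Rightarrow> real) metric)"
    by (rule Metric_space_mspace_mdist)
  let ?N = "2 * real CARD('d) + 1"
  have represent: "\<forall>f \<in> mspace (cube_fun_space :: (real ^ 'd \<Rightarrow> real) metric).
      \<exists>g. continuous_on {0..real CARD('d)} g \<and> (\<forall>x\<in>unit_cube. f x = superposition lam \<phi> g x)"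
    using K unfolding kolmogorov_data_def by (elim conjE)
  have "\<exists>h \<in> kolmogorov_class lam \<phi> k. h \<in> F.mcball f r"
    if f: "f \<in> mspace cube_fun_space" and "r > 0" for f r
  proof -
    obtain g where g: "continuous_on {0..real CARD('d)} g"
      and fg: "\<And>x. x \<in> unit_cube \<Longrightarrow> f x = superposition lam \<phi> g x"
      using represent f by blast
    \<comment> \<open>The tolerance \<open>r / ?N\<close> compensates for the 2d + 1 summands, each
      of which contributes one approximation error.\<close>
    obtain p where p: "real_polynomial_function p"
      and gp: "\<And>t. t \<in> {0..real CARD('d)} \<Longrightarrow> \<bar>g t - p t\<bar> < r / ?N"
      using Stone_Weierstrass_real_polynomial_function[OF _ g, of "r / ?N"] \<open>r > 0\<close> by auto
    have Ck: "C_k_on j {0..real CARD('d)} p" for j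
      using p by (intro C_k_on_real_polynomial_function) auto
    define h where "h = restrict (superposition lam \<phi> p) unit_cube"
    have h: "h \<in> mspace cube_fun_space"
      unfolding h_def using Ck[of 0]
      by (intro restrict_in_cube_fun_space continuous_on_superposition[OF K]) simp
    then have "h \<in> kolmogorov_class lam \<phi> k"
      using Ck[of k] unfolding kolmogorov_class_def by (auto simp: h_def)
    moreover have "\<bar>f x - h x\<bar> \<le> r" if x: "x \<in> unit_cube" for x
    proof -
      have "\<bar>superposition lam \<phi> g x - superposition lam \<phi> p x\<bar> \<le> ?N * (r / ?N)"
        using gp by (intro superposition_diff_le[OF K x]) (simp add: less_imp_le)
      also have "\<dots> = r"
        by simp
      finally show ?thesis
        using x by (simp add: fg h_def)
    qed
    then have "mdist cube_fun_space f h \<le> r"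
      using f h unit_cube_nonempty
      by (subst cfunspace_mdist_le) (auto simp: dist_real_def)
    ultimately show ?thesis
      using f h unfolding F.in_mcball by blast
  qed
  \<comment> \<open>The closure is characterised by closed balls, so the non-strict bound on the
    distance is enough.\<close>
  then have "F.mtopology closure_of kolmogorov_class lam \<phi> k = mspace cube_fun_space"
    unfolding F.metric_closure_of_alt by blast
  then show ?thesis
    by (simp only: mtopology_of_def)
qed

section \<open>Error bounds of order 1/n and 1/n^2\<close>

text \<open>The common core of both rates: \<open>e\<close> is the error of one chord over an
  interval of length 1/n, and the interpolant of \<open>g\<close> serves as
  \<open>L\<close>.\<close>

lemma superposition_grid_interpolant_error:
  fixes lam :: "'d::finite \<Rightarrow> real"
  assumes K: "kolmogorov_data \<alpha> lam \<phi>" and "n \<ge> 1"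
    and fg: "\<forall>x\<in>unit_cube. f x = superposition lam \<phi> g x"
    and cell: "\<And>a b t. \<lbrakk>a < b; b - a = 1 / real n; {a..b} \<subseteq> {0..real CARD('d)}; t \<in> {a..b}\<rbrakk>
      \<Longrightarrow> \<bar>g t - chord g a b t\<bar> \<le> e"
  shows "\<exists>L. grid_affine CARD('d) n L \<and>
    sup_norm unit_cube (\<lambda>x. f x - superposition lam \<phi> L x) \<le> (2 * real CARD('d) + 1) * e"
proof (intro exI conjI)
  have d: "CARD('d) \<ge> 1"
    by (simp add: Suc_le_eq)
  show "grid_affine CARD('d) n (grid_interpolant g n)"
    by (rule grid_affine_grid_interpolant[OF \<open>n \<ge> 1\<close> d])
  have "\<bar>g t - grid_interpolant g n t\<bar> \<le> e" if "t \<in> {0..real CARD('d)}" for t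
    using grid_interpolant_error[OF \<open>n \<ge> 1\<close> d that cell] .
  then show "sup_norm unit_cube (\<lambda>x. f x - superposition lam \<phi> (grid_interpolant g n) x)
      \<le> (2 * real CARD('d) + 1) * e"
    unfolding sup_norm_def using fg superposition_diff_le[OF K, of _ g "grid_interpolant g n" e]
    by (intro cSUP_least unit_cube_nonempty) auto
qed

lemma superposition_error_C1:
  fixes lam :: "'d::finite \<Rightarrow> real"
  assumes K: "kolmogorov_data \<alpha> lam \<phi>" and "n \<ge> 1"
    and g: "C_k_on 1 {0..real CARD('d)} g"
    and fg: "\<forall>x\<in>unit_cube. f x = superposition lam \<phi> g x"
  shows "\<exists>L. grid_affine CARD('d) n L \<and>
    sup_norm unit_cube (\<lambda>x. f x - superposition lam \<phi> L x)
      \<le> (2 * real CARD('d) + 1) / 2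
         * sup_norm {0..real CARD('d)} (deriv_on {0..real CARD('d)} g) / real n ^ 1"
proof -
  let ?S = "{0..real CARD('d)}"
  let ?M = "sup_norm ?S (deriv_on ?S g)"
  have diff: "g differentiable_on ?S" and cont: "continuous_on ?S (deriv_on ?S g)"
    using g by simp_all
  \<comment> \<open>The chord estimate for cell length 1/n, with the supremum norm of the derivative
    as bound.\<close>
  have cell: "\<bar>g t - chord g a b t\<bar> \<le> ?M * (1 / real n) / 2"
    if "a < b" "b - a = 1 / real n" "{a..b} \<subseteq> ?S" "t \<in> {a..b}" for a b t
    using chord_error_C1[OF that(1,4,3) has_real_derivative_deriv_on[OF diff]
        abs_le_sup_norm[OF cont compact_Icc]] that(2)
    by simp
  show ?thesis
    using superposition_grid_interpolant_error[OF K \<open>n \<ge> 1\<close> fg cell] by (simp add: algebra_simps)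
qed

lemma superposition_error_C2:
  fixes lam :: "'d::finite \<Rightarrow> real"
  assumes K: "kolmogorov_data \<alpha> lam \<phi>" and "n \<ge> 1"
    and g: "C_k_on 2 {0..real CARD('d)} g"
    and fg: "\<forall>x\<in>unit_cube. f x = superposition lam \<phi> g x"
  shows "\<exists>L. grid_affine CARD('d) n L \<and>
    sup_norm unit_cube (\<lambda>x. f x - superposition lam \<phi> L x)
      \<le> (2 * real CARD('d) + 1) / 8
         * sup_norm {0..real CARD('d)}
             (deriv_on {0..real CARD('d)} (deriv_on {0..real CARD('d)} g)) / real n ^ 2"
proof -
  let ?S = "{0..real CARD('d)}"
  let ?M = "sup_norm ?S (deriv_on ?S (deriv_on ?S g))"
  have diff: "g differentiable_on ?S" "deriv_on ?S g differentiable_on ?S"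
    and cont: "continuous_on ?S (deriv_on ?S (deriv_on ?S g))"
    using g by (simp_all add: numeral_2_eq_2)
  \<comment> \<open>The second derivative is bounded by its supremum norm; the squared cell length
    produces the second-order rate.\<close>
  have cell: "\<bar>g t - chord g a b t\<bar> \<le> ?M * (1 / real n)\<^sup>2 / 8"
    if "a < b" "b - a = 1 / real n" "{a..b} \<subseteq> ?S" "t \<in> {a..b}" for a b t
    using chord_error_C2[OF that(1,4,3) has_real_derivative_deriv_on[OF diff(1)]
        has_real_derivative_deriv_on[OF diff(2)] abs_le_sup_norm[OF cont compact_Icc]] that(2)
    by simp
  show ?thesis
    using superposition_grid_interpolant_error[OF K \<open>n \<ge> 1\<close> fg cell]
    by (simp add: power_one_over algebra_simps)
qed

theorem mainTheorem4:
  fixes \<alpha> :: real and lam :: "'d::finite \<Rightarrow> real" and \<phi> :: "nat \<Rightarrow> real \<Rightarrow> real"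
  assumes "kolmogorov_data \<alpha> lam \<phi>"
  shows
    "(\<forall>k\<in>{1, 2}.
        mtopology_of cube_fun_space closure_of kolmogorov_class lam \<phi> k = mspace cube_fun_space) \<and>
     (\<forall>k\<in>{1, 2}. \<forall>f\<in>kolmogorov_class lam \<phi> k. \<exists>C. \<forall>n\<ge>1. \<exists>L. grid_affine CARD('d) n L \<and>
        sup_norm unit_cube (\<lambda>x. f x - superposition lam \<phi> L x) \<le> C / real n ^ k) \<and>
     (\<forall>f\<in>kolmogorov_class lam \<phi> 1. \<forall>g.
        C_k_on 1 {0..real CARD('d)} g \<and> (\<forall>x\<in>unit_cube. f x = superposition lam \<phi> g x) \<longrightarrow>
        (\<forall>n\<ge>1. \<exists>L. grid_affine CARD('d) n L \<and>
           sup_norm unit_cube (\<lambda>x. f x - superposition lam \<phi> L x)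
             \<le> (2 * real CARD('d) + 1) / 2
                * sup_norm {0..real CARD('d)} (deriv_on {0..real CARD('d)} g) / real n ^ 1)) \<and>
     (\<forall>f\<in>kolmogorov_class lam \<phi> 2. \<forall>g.
        C_k_on 2 {0..real CARD('d)} g \<and> (\<forall>x\<in>unit_cube. f x = superposition lam \<phi> g x) \<longrightarrow>
        (\<forall>n\<ge>1. \<exists>L. grid_affine CARD('d) n L \<and>
           sup_norm unit_cube (\<lambda>x. f x - superposition lam \<phi> L x)
             \<le> (2 * real CARD('d) + 1) / 8
                * sup_norm {0..real CARD('d)}
                    (deriv_on {0..real CARD('d)} (deriv_on {0..real CARD('d)} g)) / real n ^ 2)) \<and>
     (\<forall>n\<ge>1. \<forall>L M. grid_affine CARD('d) n L \<and> grid_affine CARD('d) n M \<and>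
        (\<forall>i\<in>{0..n * CARD('d)}. L (real i / real n) = M (real i / real n)) \<longrightarrow>
        (\<forall>t\<in>{0..real CARD('d)}. L t = M t))"
proof -
  have class_g: "\<exists>g. C_k_on k {0..real CARD('d)} g \<and> (\<forall>x\<in>unit_cube. f x = superposition lam \<phi> g x)"
    if "f \<in> kolmogorov_class lam \<phi> k" for f k
    using that unfolding kolmogorov_class_def by blast
  \<comment> \<open>The representing \<open>g\<close> is chosen before \<open>n\<close>, so the
    explicit constant built from its derivative is independent of \<open>n\<close>.\<close>
  have rate1: "\<exists>C. \<forall>n\<ge>1. \<exists>L. grid_affine CARD('d) n L \<and>
      sup_norm unit_cube (\<lambda>x. f x - superposition lam \<phi> L x) \<le> C / real n ^ 1"
    if "f \<in> kolmogorov_class lam \<phi> 1" for f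
    using class_g[OF that] superposition_error_C1[OF assms] by meson
  have rate2: "\<exists>C. \<forall>n\<ge>1. \<exists>L. grid_affine CARD('d) n L \<and>
      sup_norm unit_cube (\<lambda>x. f x - superposition lam \<phi> L x) \<le> C / real n ^ 2"
    if "f \<in> kolmogorov_class lam \<phi> 2" for f
    using class_g[OF that] superposition_error_C2[OF assms] by meson
  have d: "CARD('d) \<ge> 1"
    by (simp add: Suc_le_eq)
  show ?thesis
  proof (intro conjI)
    show "\<forall>k\<in>{1, 2}. mtopology_of cube_fun_space closure_of kolmogorov_class lam \<phi> k = mspace cube_fun_space"
      using kolmogorov_class_dense[OF assms] by blast
    show "\<forall>k\<in>{1, 2}. \<forall>f\<in>kolmogorov_class lam \<phi> k. \<exists>C. \<forall>n\<ge>1. \<exists>L. grid_affine CARD('d) n L \<and>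
        sup_norm unit_cube (\<lambda>x. f x - superposition lam \<phi> L x) \<le> C / real n ^ k"
      using rate1 rate2 by blast
  \<comment> \<open>What remains are the two explicit constants, valid for every representing
    \<open>g\<close>, and the determination of \<open>L\<close> by its node values.\<close>
  qed (use superposition_error_C1[OF assms] superposition_error_C2[OF assms]
      grid_affine_unique[OF _ d] in blast)+
qed

end
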